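(* For $n\ge1$, every complete subgraph of the parity-constrained Hanoi graph $P^n$ has all its edges corresponding to moves of a single disc, and this disc is necessarily disc $1$ or disc $2$. In particular, $\omega(P^n)=3$.
   Context: Let $Q=\{0,1,2,3\}$ (pegs: $0,3$ neutral; $1$ reserved for even discs; $2$ reserved for odd discs). For a disc $d\in\{1,\dots,n\}$ let $p(d)=1$ if $d$ is even and $p(d)=2$ if $d$ is odd, and $Q^d=\{0,p(d),3\}$. The vertices of $P^n$ are words $s=s_n\cdots s_1\in Q^n$ ($s_d$ is the peg of disc $d$) with $s_d\in Q^d$ for all $d$. Two vertices are adjacent iff they differ in exactly one coordinate $d$, with values $i\ne j$ there, $i,j\in Q^d$, and $s_k\notin\{i,j\}$ for all $k<d$; such an edge is said to correspond to a move of disc $d$. $\omega$ denotes the clique number.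
   Formalization: That the disc is 1 or 2 is claimed only for complete subgraphs with at least 3 vertices: a single edge is also complete, and for n ≥ 3 it can move disc 3 (from peg 0 to 2 with discs 1 and 2 on peg 3). *)

theory Defs
  imports "Graph_Theory.Graph_Theory" "HOL-Library.FuncSet"
begin

definition reserved_peg :: "nat \<Rightarrow> nat" where
  "reserved_peg d = (if even d then 1 else 2)"

definition allowed_pegs :: "nat \<Rightarrow> nat set" where
  "allowed_pegs d = {0, reserved_peg d, 3}"

text \<open>
  The word \<open>s\<^sub>n \<dots> s\<^sub>1\<close> is the extensional function \<open>s\<close> on \<open>{1..n}\<close>, with \<open>s d\<close> the peg of
  disc \<open>d\<close>. Disc 1 is the smallest disc.
\<close>

definition hanoi_states :: "nat \<Rightarrow> (nat \<Rightarrow> nat) set" where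
  "hanoi_states n = (\<Pi>\<^sub>E d\<in>{1..n}. allowed_pegs d)"

definition moves_disc :: "nat \<Rightarrow> nat \<Rightarrow> (nat \<Rightarrow> nat) \<Rightarrow> (nat \<Rightarrow> nat) \<Rightarrow> bool" where
  "moves_disc n d s t \<longleftrightarrow>
     s \<in> hanoi_states n \<and> t \<in> hanoi_states n \<and> d \<in> {1..n} \<and>
     s d \<noteq> t d \<and> (\<forall>k\<in>{1..n} - {d}. s k = t k) \<and>
     (\<forall>k\<in>{1..<d}. s k \<notin> {s d, t d})"

text \<open>
  Undirected graphs are symmetric digraphs, as in \<open>Graph_Theory\<close>: an edge is a pair of opposite
  arcs.
\<close>

definition parity_hanoi :: "nat \<Rightarrow> (nat \<Rightarrow> nat, (nat \<Rightarrow> nat) \<times> (nat \<Rightarrow> nat)) pre_digraph" where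
  "parity_hanoi n = with_proj
     \<lparr> pverts = hanoi_states n, parcs = {(s, t). \<exists>d. moves_disc n d s t} \<rparr>"

definition clique_number :: "('a, 'b) pre_digraph \<Rightarrow> nat" where
  "clique_number G = Max {m. \<exists>H. subgraph H G \<and> complete_digraph m H}"

lemma finite_hanoi_states: "finite (hanoi_states n)"
  unfolding hanoi_states_def allowed_pegs_def by (intro finite_PiE) auto

lemma moves_disc_sym: "moves_disc n d s t \<Longrightarrow> moves_disc n d t s"
  unfolding moves_disc_def by (elim conjE, intro conjI ballI) (auto simp: Ball_def)

lemma graph_parity_hanoi: "graph (parity_hanoi n)"
proof -
  define G where "G = \<lparr> pverts = hanoi_states n, parcs = {(s, t). \<exists>d. moves_disc n d s t} \<rparr>"
  have sub: "parcs G \<subseteq> pverts G \<times> pverts G"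
    unfolding G_def moves_disc_def by auto
  have fin: "finite (pverts G)"
    unfolding G_def by (simp add: finite_hanoi_states)
  have fin': "finite (parcs G)"
    using sub fin by (meson finite_SigmaI finite_subset)
  have sym: "sym (parcs G)"
    unfolding G_def by (rule symI) (use moves_disc_sym in simp, blast)
  have loopfree: "fst e \<noteq> snd e" if "e \<in> parcs G" for e
    using that unfolding G_def moves_disc_def by auto
  interpret pair_graph G
  proof
    show "fst e \<in> pverts G" "snd e \<in> pverts G" if "e \<in> parcs G" for e
      using that sub by auto
    show "symmetric (with_proj G)"
      using sym by (simp add: symmetric_def)
  qed (use fin fin' loopfree in auto)
  have "graph (with_proj G)" by unfold_locales
  then show ?thesis
    unfolding parity_hanoi_def G_def .
qed

end

(* In a triangle, two moves of different discs would make the third pair of states differ in two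
   coordinates; so all three edges move one disc d, and hence so do all edges of a clique. Three
   states that differ pairwise in disc d put d on all of its allowed pegs, which blocks
   every smaller disc of the same parity; so d - 2 is not a disc. Finally, clique vertices are
   separated by the position of disc d, which has only three allowed pegs. *)
theory Submission
  imports Defs
begin

lemma moves_disc_triangle:
  assumes st: "moves_disc n d s t" and tu: "moves_disc n e t u" and su: "moves_disc n f s u"
  shows "e = d" "f = d"
proof -
  have dom: "d \<in> {1..n}" "e \<in> {1..n}" using st tu by (auto simp: moves_disc_def)
  have only_f: "s k = u k" if "k \<in> {1..n}" "k \<noteq> f" for k
    using su that by (auto simp: moves_disc_def)
  show "e = d"
  proof (rule ccontr)
    assume "e \<noteq> d"
    \<comment> \<open>Disc \<open>d\<close> rests from \<open>t\<close> to \<open>u\<close> and disc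
      \<open>e\<close> rests from \<open>s\<close> to \<open>t\<close>, so both changes survive in
      the pair \<open>s\<close>, \<open>u\<close>.\<close>
    then have "s d \<noteq> u d" "s e \<noteq> u e"
      using st tu dom by (auto simp: moves_disc_def)
    then show False using only_f dom \<open>e \<noteq> d\<close> by metis
  qed
  show "f = d"
  proof (rule ccontr)
    assume "f \<noteq> d"
    \<comment> \<open>Both steps through \<open>t\<close> now move \<open>d\<close>, so any other
      coordinate is constant along \<open>s\<close>, \<open>t\<close>, \<open>u\<close>.\<close>
    then have "f \<in> {1..n}" "s f = t f" "t f = u f" "s f \<noteq> u f"
      using st tu su \<open>e = d\<close> by (auto simp: moves_disc_def)
    then show False by simp
  qed
qed

lemma card_allowed_pegs: "card (allowed_pegs d) = 3"
  by (simp add: allowed_pegs_def reserved_peg_def)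

lemma moves_disc_triangle_le_2:
  assumes st: "moves_disc n d s t" and tu: "moves_disc n d t u" and su: "moves_disc n d s u"
  shows "d = 1 \<or> d = 2"
proof (rule ccontr)
  assume "\<not> (d = 1 \<or> d = 2)"
  then have d: "d \<ge> 3" "d \<le> n" using st by (auto simp: moves_disc_def)
  \<comment> \<open>The next smaller disc of the same parity; \<open>d \<ge> 3\<close> ensures that
    it is at least 1.\<close>
  define k where "k = d - 2"
  have k: "k \<in> {1..<d}" "k \<in> {1..n}" using d by (auto simp: k_def)
  have "even k \<longleftrightarrow> even d" using d by (simp add: k_def)
  then have pegs: "allowed_pegs k = allowed_pegs d"
    by (simp add: allowed_pegs_def reserved_peg_def)
  have "{s d, t d, u d} \<subseteq> allowed_pegs d"
    using st tu by (auto simp: moves_disc_def hanoi_states_def)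
  moreover have "card {s d, t d, u d} = 3"
    using st tu su by (simp add: moves_disc_def)
  ultimately have "{s d, t d, u d} = allowed_pegs d"
    by (metis card_allowed_pegs card_subset_eq finite.emptyI finite.insertI allowed_pegs_def)
  moreover have "s k \<in> allowed_pegs d"
    using st k pegs by (auto simp: moves_disc_def hanoi_states_def)
  \<comment> \<open>The move from \<open>s\<close> to \<open>t\<close> keeps \<open>k\<close> off
    the first two pegs, the move from \<open>s\<close> to \<open>u\<close> off the third.\<close>
  moreover have "s k \<notin> {s d, t d, u d}"
    using st su k by (auto simp: moves_disc_def)
  ultimately show False by simp
qed

text \<open>Completeness is stated through \<open>arcs_ends\<close>. A subgraph inherits the
  projections of \<open>parity_hanoi n\<close>, where an arc is its own pair of ends, so adjacency
  in \<open>H\<close> translates into moves.\<close>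

lemma complete_subgraph_moves:
  assumes "subgraph H (parity_hanoi n)" "complete_digraph m H"
  shows "e \<in> arcs H \<Longrightarrow> tail H e \<in> verts H \<and> head H e \<in> verts H \<and> tail H e \<noteq> head H e"
    and "\<lbrakk>u \<in> verts H; v \<in> verts H; u \<noteq> v\<rbrakk> \<Longrightarrow> \<exists>d. moves_disc n d u v"
    and "verts H \<subseteq> hanoi_states n" "card (verts H) = m"
proof -
  have ends: "arcs_ends H = {(u, v). (u, v) \<in> verts H \<times> verts H \<and> u \<noteq> v}"
    using assms(2) by (simp add: complete_digraph_def)
  show "e \<in> arcs H \<Longrightarrow> tail H e \<in> verts H \<and> head H e \<in> verts H \<and> tail H e \<noteq> head H e"
    using ends by (auto simp: arcs_ends_conv set_eq_iff image_iff)
  show "\<exists>d. moves_disc n d u v" if "u \<in> verts H" "v \<in> verts H" "u \<noteq> v"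
  proof -
    have "(u, v) \<in> arcs_ends H" using that ends by simp
    then show ?thesis
      using assms(1) by (auto simp: arcs_ends_conv subgraph_def compatible_def parity_hanoi_def)
  qed
  show "verts H \<subseteq> hanoi_states n" "card (verts H) = m"
    using assms by (auto simp: subgraph_def parity_hanoi_def complete_digraph_def)
qed

text \<open>The triangles \<open>s\<close>, \<open>t\<close>, \<open>u\<close> carry
  \<open>d\<close> from the edge \<open>st\<close> to every edge at \<open>s\<close>; the triangle
  \<open>s\<close>, \<open>x\<close>, \<open>y\<close> then carries it to \<open>xy\<close>.\<close>

lemma pairwise_moves_same_disc:
  assumes adj: "\<And>u v. \<lbrakk>u \<in> V; v \<in> V; u \<noteq> v\<rbrakk> \<Longrightarrow> \<exists>e. moves_disc n e u v"
    and s: "s \<in> V" and t: "t \<in> V" and st: "moves_disc n d s t"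
    and x: "x \<in> V" and y: "y \<in> V" and xy: "x \<noteq> y"
  shows "moves_disc n d x y"
proof -
  have from_s: "moves_disc n d s u" if u: "u \<in> V" "s \<noteq> u" for u
  proof (cases "u = t")
    case False
    then show ?thesis
      using adj[OF t u(1)] adj[OF s u] moves_disc_triangle(2)[OF st] by metis
  qed (use st in simp)
  obtain e where e: "moves_disc n e x y" using adj[OF x y xy] by auto
  consider "x = s" | "y = s" | "s \<noteq> x" "s \<noteq> y" by auto
  then show ?thesis
  proof cases
    case 1 then show ?thesis using from_s y xy by auto
  next
    case 2 then show ?thesis using from_s x xy by (auto intro: moves_disc_sym)
  next
    case 3
    have "e = d"
      using moves_disc_triangle(1)[OF from_s[OF x 3(1)] e from_s[OF y 3(2)]] .
    then show ?thesis using e by simp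
  qed
qed

text \<open>A lone edge can move any disc, from peg 0 to peg 3 with all smaller discs on their
  reserved pegs. Only a third vertex forces \<open>d\<close> to be 1 or 2, hence the guard
  \<open>m \<ge> 3\<close>.\<close>

lemma complete_subgraph_single_disc:
  assumes "n \<ge> 1" and H: "subgraph H (parity_hanoi n)" "complete_digraph m H"
  shows "\<exists>d\<in>{1..n}. (\<forall>u\<in>verts H. \<forall>v\<in>verts H. u \<noteq> v \<longrightarrow> moves_disc n d u v) \<and>
           (m \<ge> 3 \<longrightarrow> d = 1 \<or> d = 2)"
proof (cases "\<exists>s\<in>verts H. \<exists>t\<in>verts H. s \<noteq> t")
  case True
  note adj = complete_subgraph_moves(2)[OF H]
  from True obtain s t where st: "s \<in> verts H" "t \<in> verts H" "s \<noteq> t" by blast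
  then obtain d where d: "moves_disc n d s t" using adj by blast
  have all: "moves_disc n d u v" if "u \<in> verts H" "v \<in> verts H" "u \<noteq> v" for u v
    using pairwise_moves_same_disc[OF adj st(1,2) d that] .
  have "d = 1 \<or> d = 2" if "m \<ge> 3"
  proof -
    have "\<not> verts H \<subseteq> {s, t}"
    proof
      assume "verts H \<subseteq> {s, t}"
      then have "card (verts H) \<le> card {s, t}" by (intro card_mono) auto
      then show False using that st(3) complete_subgraph_moves(4)[OF H] by simp
    qed
    then obtain u where u: "u \<in> verts H" "s \<noteq> u" "t \<noteq> u" by blast
    show ?thesis
      using moves_disc_triangle_le_2[OF d all[OF st(2) u(1,3)] all[OF st(1) u(1,2)]] .
  qed
  moreover have "d \<in> {1..n}" using d by (simp add: moves_disc_def)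
  ultimately show ?thesis using all by blast
next
  case False
  \<comment> \<open>There are no two distinct vertices, so the claim on moves is vacuous; disc 1
    exists as \<open>n \<ge> 1\<close>.\<close>
  then show ?thesis using \<open>n \<ge> 1\<close> by (intro bexI[of _ 1]) auto
qed

lemma complete_subgraph_order_le_3:
  assumes "n \<ge> 1" and H: "subgraph H (parity_hanoi n)" "complete_digraph m H"
  shows "m \<le> 3"
proof -
  obtain d where d: "d \<in> {1..n}"
    and all: "\<And>u v. \<lbrakk>u \<in> verts H; v \<in> verts H; u \<noteq> v\<rbrakk> \<Longrightarrow> moves_disc n d u v"
    using complete_subgraph_single_disc[OF assms] by blast
  have "inj_on (\<lambda>u. u d) (verts H)"
    using all by (auto simp: inj_on_def moves_disc_def)
  moreover have "(\<lambda>u. u d) ` verts H \<subseteq> allowed_pegs d"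
    using complete_subgraph_moves(3)[OF H] d by (auto simp: hanoi_states_def dest!: subsetD)
  moreover have "finite (allowed_pegs d)" by (simp add: allowed_pegs_def)
  ultimately have "card (verts H) \<le> card (allowed_pegs d)" by (rule card_inj_on_le)
  then show ?thesis using complete_subgraph_moves(4)[OF H] by (simp add: card_allowed_pegs)
qed

text \<open>The smallest disc moves freely among its three allowed pegs while all other discs stay
  put.\<close>

lemma ex_complete_subgraph_3:
  assumes "n \<ge> 1"
  shows "\<exists>H. subgraph H (parity_hanoi n) \<and> complete_digraph 3 H"
proof -
  \<comment> \<open>Peg 0 is allowed for every disc, so the others can be parked there. The
    restricted abstraction makes the word extensional, as \<open>hanoi_states\<close>
    demands.\<close>
  define w :: "nat \<Rightarrow> nat \<Rightarrow> nat" where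
    "w p = (\<lambda>k\<in>{1..n}. if k = 1 then p else 0)" for p
  define V where "V = w ` allowed_pegs 1"
  define H where "H = with_proj \<lparr>pverts = V, parcs = {(u, v). (u, v) \<in> V \<times> V \<and> u \<noteq> v}\<rparr>"
  have w_1: "w p 1 = p" for p using assms by (simp add: w_def)
  then have "inj w" by (metis injI)
  then have "card V = 3"
    unfolding V_def by (metis card_image card_allowed_pegs inj_on_subset subset_UNIV)
  moreover have "finite V" by (simp add: V_def allowed_pegs_def)
  ultimately have complete: "complete_digraph 3 H"
    by (simp add: H_def complete_digraph_pair_def)
  have states: "w p \<in> hanoi_states n" if "p \<in> allowed_pegs 1" for p
    using that by (auto simp: w_def hanoi_states_def allowed_pegs_def)
  \<comment> \<open>No disc is smaller than disc 1, so the blocking condition is vacuous.\<close>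
  have "moves_disc n 1 (w p) (w q)"
    if "p \<in> allowed_pegs 1" "q \<in> allowed_pegs 1" "p \<noteq> q" for p q
    using that assms states unfolding moves_disc_def w_1 by (simp add: w_def)
  then have arcs: "arcs H \<subseteq> arcs (parity_hanoi n)"
    by (auto simp: H_def V_def parity_hanoi_def)
  have "wf_digraph H"
    using complete
    by (auto simp: complete_digraph_def graph_def digraph_def fin_digraph_def)
  moreover have "wf_digraph (parity_hanoi n)"
    using graph_parity_hanoi[of n] by (auto simp: graph_def digraph_def fin_digraph_def)
  ultimately have "subgraph H (parity_hanoi n)"
    using arcs states
    by (auto simp: subgraph_def compatible_def H_def V_def parity_hanoi_def)
  with complete show ?thesis by blast
qed

theorem theorem6p22:
  fixes n :: nat
  assumes "n \<ge> 1"
  shows "(\<forall>H m. subgraph H (parity_hanoi n) \<and> complete_digraph m H \<longrightarrow>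
            (\<exists>d\<in>{1..n}. (\<forall>e\<in>arcs H. moves_disc n d (tail H e) (head H e)) \<and>
                        (m \<ge> 3 \<longrightarrow> d = 1 \<or> d = 2))) \<and>
         clique_number (parity_hanoi n) = 3"
proof (intro conjI allI impI)
  fix H :: "(nat \<Rightarrow> nat, (nat \<Rightarrow> nat) \<times> (nat \<Rightarrow> nat)) pre_digraph" and m
  assume "subgraph H (parity_hanoi n) \<and> complete_digraph m H"
  then have H: "subgraph H (parity_hanoi n)" "complete_digraph m H" by auto
  show "\<exists>d\<in>{1..n}. (\<forall>e\<in>arcs H. moves_disc n d (tail H e) (head H e)) \<and>
          (m \<ge> 3 \<longrightarrow> d = 1 \<or> d = 2)"
    using complete_subgraph_single_disc[OF assms H] complete_subgraph_moves(1)[OF H] by blast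
next
  let ?M = "{m. \<exists>H. subgraph H (parity_hanoi n) \<and> complete_digraph m H}"
  have le: "m \<le> 3" if "m \<in> ?M" for m
    using that complete_subgraph_order_le_3[OF assms] by blast
  \<comment> \<open>The bound 3 serves twice: it makes the set finite, so that \<open>Max\<close> is
    meaningful, and it bounds the maximum from above.\<close>
  then have "finite ?M" by (meson finite_nat_set_iff_bounded_le)
  then show "clique_number (parity_hanoi n) = 3"
    unfolding clique_number_def
    using le ex_complete_subgraph_3[OF assms] by (intro Max_eqI) auto
qed

end
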